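(* For all $n\ge 1$ and $0\le k\le\lfloor n/2\rfloor$, $$\sum_{\sigma\in\overline{\mathcal Y}^*_{2n+1,k}}p^{(2\text{-}13)\sigma}q^{(31\text{-}2)\sigma}=(p+q)^{2k}\sum_{\sigma\in\widehat{\mathcal Y}^*_{2n+1,k}}p^{(2\text{-}13)\sigma-2k}\,q^{(31\text{-}2)\sigma}.$$
   Context: Permutations $\sigma\in\mathfrak S_m$ of $[m]=\{1,\dots,m\}$ are written as words $\sigma_1\cdots\sigma_m$. A descent of $\sigma$ is a pair $(\sigma_i,\sigma_{i+1})$, $1\le i\le m-1$, with $\sigma_i>\sigma_{i+1}$. $\mathcal Y^*_{2n+1}$ is the set of $\sigma\in\mathfrak S_{2n+1}$ such that every descent has both entries odd, and such that $\sigma_{2n+1}$ is odd. With the convention $\sigma_0=\sigma_{m+1}=0$ for $\sigma\in\mathfrak S_m$, the value $\sigma_i$ ($1\le i\le m$) is a peak if $\sigma_{i-1}<\sigma_i>\sigma_{i+1}$, a valley if $\sigma_{i-1}>\sigma_i<\sigma_{i+1}$, and a double descent if $\sigma_{i-1}>\sigma_i>\sigma_{i+1}$. An $\mathcal F$-permutation is a $\sigma\in\mathcal Y^*_{2n+1}$ with no double descent and whose last entry is a peak, i.e. $\sigma_{2n}<\sigma_{2n+1}$. $\overline{\mathcal Y}^*_{2n+1}$ is the set of $\mathcal F$-permutations in $\mathfrak S_{2n+1}$, and $\overline{\mathcal Y}^*_{2n+1,k}$ the subset of those with $k$ descents. For $\sigma\in\mathfrak S_m$: $(31\text{-}2)\sigma$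 is the number of pairs $(i,j)$ with $2\le i<j\le m$ and $\sigma_{i-1}>\sigma_j>\sigma_i$; $(2\text{-}13)\sigma$ is the number of pairs $(i,j)$ with $1\le i<j\le m-1$ and $\sigma_{j+1}>\sigma_i>\sigma_j$. For a value $v=\sigma_j$, $l_\sigma(v)$ is the number of $i$ with $2\le i<j$ and $\sigma_{i-1}>v>\sigma_i$. Let $\sigma\in\overline{\mathcal Y}^*_{2n+1}$. For $j\in[2n]$ let $a(j)=f(j)-g(j)+1$, where $f(j)$ (resp. $g(j)$) is the number of valleys (resp. peaks) of $\sigma$ with value less than $j$. For $i\in[n]$, $x=\{2i-1,2i\}$ is a VOP pair of $\sigma$ if $2i-1$ is a valley or a peak of $\sigma$; its embracing number is $l_\sigma(x)=l_\sigma(2i-1)$ if $a(2i-1)$ is even, and $l_\sigma(x)=l_\sigma(2i)$ if $a(2i-1)$ is odd. $\sigma$ is normalized if $l_\sigma(x)$ is even for every VOP pair $x$ of $\sigma$. $\widehat{\mathcal Y}^*_{2n+1,k}$ is the set of normalized $\sigma\in\overline{\mathcal Y}^*_{2n+1}$ with $k$ descents. *)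

theory Defs
  imports "HOL-Combinatorics.Permutations"
begin

text \<open>
  A permutation of \<open>{1..m}\<close> is a function \<open>\<sigma>\<close> with \<open>\<sigma> permutes {1..m}\<close>, read as the word
  \<open>\<sigma> 1, \<dots>, \<sigma> m\<close>.  Such a function is the identity outside \<open>{1..m}\<close>, so the boundary convention
  of value 0 at positions 0 and \<open>m + 1\<close> has to be imposed separately.
\<close>

definition letter :: "nat \<Rightarrow> (nat \<Rightarrow> nat) \<Rightarrow> nat \<Rightarrow> nat" where
  "letter m \<sigma> i = (if i \<in> {1..m} then \<sigma> i else 0)"

definition peaks :: "nat \<Rightarrow> (nat \<Rightarrow> nat) \<Rightarrow> nat set" where
  "peaks m \<sigma> = {\<sigma> i | i. i \<in> {1..m} \<and>
     letter m \<sigma> (i - 1) < letter m \<sigma> i \<and> letter m \<sigma> i > letter m \<sigma> (i + 1)}"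

definition valleys :: "nat \<Rightarrow> (nat \<Rightarrow> nat) \<Rightarrow> nat set" where
  "valleys m \<sigma> = {\<sigma> i | i. i \<in> {1..m} \<and>
     letter m \<sigma> (i - 1) > letter m \<sigma> i \<and> letter m \<sigma> i < letter m \<sigma> (i + 1)}"

definition double_descents :: "nat \<Rightarrow> (nat \<Rightarrow> nat) \<Rightarrow> nat set" where
  "double_descents m \<sigma> = {\<sigma> i | i. i \<in> {1..m} \<and>
     letter m \<sigma> (i - 1) > letter m \<sigma> i \<and> letter m \<sigma> i > letter m \<sigma> (i + 1)}"

definition descents :: "nat \<Rightarrow> (nat \<Rightarrow> nat) \<Rightarrow> (nat \<times> nat) set" where
  "descents m \<sigma> = {(\<sigma> i, \<sigma> (i + 1)) | i. 1 \<le> i \<and> i + 1 \<le> m \<and> \<sigma> i > \<sigma> (i + 1)}"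

definition Ystar :: "nat \<Rightarrow> (nat \<Rightarrow> nat) set" where
  "Ystar n = {\<sigma>. \<sigma> permutes {1..2 * n + 1} \<and>
     (\<forall>(a, b) \<in> descents (2 * n + 1) \<sigma>. odd a \<and> odd b) \<and> odd (\<sigma> (2 * n + 1))}"

definition F_perms :: "nat \<Rightarrow> (nat \<Rightarrow> nat) set" where
  "F_perms n = {\<sigma> \<in> Ystar n. double_descents (2 * n + 1) \<sigma> = {} \<and>
     \<sigma> (2 * n + 1) \<in> peaks (2 * n + 1) \<sigma>}"

definition F_perms_des :: "nat \<Rightarrow> nat \<Rightarrow> (nat \<Rightarrow> nat) set" where
  "F_perms_des n k = {\<sigma> \<in> F_perms n. card (descents (2 * n + 1) \<sigma>) = k}"

definition stat_31_2 :: "nat \<Rightarrow> (nat \<Rightarrow> nat) \<Rightarrow> nat" where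
  "stat_31_2 m \<sigma> = card {(i, j). 2 \<le> i \<and> i < j \<and> j \<le> m \<and> \<sigma> (i - 1) > \<sigma> j \<and> \<sigma> j > \<sigma> i}"

definition stat_2_13 :: "nat \<Rightarrow> (nat \<Rightarrow> nat) \<Rightarrow> nat" where
  "stat_2_13 m \<sigma> = card {(i, j). 1 \<le> i \<and> i < j \<and> j + 1 \<le> m \<and> \<sigma> (j + 1) > \<sigma> i \<and> \<sigma> i > \<sigma> j}"

text \<open>The argument \<open>v\<close> is a value; its position in the word is \<open>inv \<sigma> v\<close>.\<close>

definition embracing :: "(nat \<Rightarrow> nat) \<Rightarrow> nat \<Rightarrow> nat" where
  "embracing \<sigma> v = card {i. 2 \<le> i \<and> i < inv \<sigma> v \<and> \<sigma> (i - 1) > v \<and> v > \<sigma> i}"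

definition a_stat :: "nat \<Rightarrow> (nat \<Rightarrow> nat) \<Rightarrow> nat \<Rightarrow> int" where
  "a_stat n \<sigma> j = int (card {v \<in> valleys (2 * n + 1) \<sigma>. v < j})
     - int (card {v \<in> peaks (2 * n + 1) \<sigma>. v < j}) + 1"

text \<open>The pair \<open>{2 * i - 1, 2 * i}\<close> is represented by its index \<open>i\<close>.\<close>

definition VOP_pairs :: "nat \<Rightarrow> (nat \<Rightarrow> nat) \<Rightarrow> nat set" where
  "VOP_pairs n \<sigma> = {i \<in> {1..n}. 2 * i - 1 \<in> valleys (2 * n + 1) \<sigma> \<union> peaks (2 * n + 1) \<sigma>}"

definition pair_embracing :: "nat \<Rightarrow> (nat \<Rightarrow> nat) \<Rightarrow> nat \<Rightarrow> nat" where
  "pair_embracing n \<sigma> i =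
     (if even (a_stat n \<sigma> (2 * i - 1)) then embracing \<sigma> (2 * i - 1) else embracing \<sigma> (2 * i))"

definition normalized :: "nat \<Rightarrow> (nat \<Rightarrow> nat) \<Rightarrow> bool" where
  "normalized n \<sigma> \<longleftrightarrow> (\<forall>i \<in> VOP_pairs n \<sigma>. even (pair_embracing n \<sigma> i))"

definition normalized_F_perms_des :: "nat \<Rightarrow> nat \<Rightarrow> (nat \<Rightarrow> nat) set" where
  "normalized_F_perms_des n k = {\<sigma> \<in> F_perms_des n k. normalized n \<sigma>}"

end

theory Submission
  imports Defs "HOL-Library.FuncSet"
begin

text \<open>
  A permutation of \<open>{1..m}\<close> is built by inserting the letters \<open>1, \<dots>, m\<close> in increasing order into
  a word with gaps, where a gap marks a place that larger letters will occupy. The initial word is a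
  single gap. A letter \<open>u\<close> goes into one of the gaps; it closes the gap if it is a peak, leaves a gap
  on both sides if it is a valley, and leaves one gap otherwise. If there are \<open>a\<close> gaps and \<open>l\<close> of
  them lie to the left of the chosen one, then in the finished permutation exactly \<open>l\<close> descents to
  the left of \<open>u\<close> and \<open>a - 1 - l\<close> ascents to the right of \<open>u\<close> pass over \<open>u\<close>. So \<open>l\<close> is the
  embracing number of \<open>u\<close>, the statistic \<open>31-2\<close> is the sum of all \<open>l\<close>, and \<open>2-13\<close> is the sum of
  all \<open>a - 1 - l\<close>. The shapes of the letters (peak, valley, double ascent or double descent) determine
  the numbers \<open>a\<close>. Therefore the permutations with given shapes correspond bijectively to arbitrary
  sequences of choices of \<open>l\<close> (\<open>bij_betw_perms_of_shape\<close>), and their generating function is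
  the product over the letters of the sums of \<open>p ^ (a - 1 - l) * q ^ l\<close> over \<open>l < a\<close>
  (\<open>sum_perms_of_shape\<close>).

  Whether a permutation is an \<open>\<F>\<close>-permutation with \<open>k\<close> descents depends on the shapes only
  (\<open>F_perms_des_iff\<close>), so the identity can be proved for one shape at a time. For even
  \<open>a\<close>, the factor of a letter is \<open>p + q\<close> times its part with \<open>l\<close> even, divided by \<open>p\<close>
  (\<open>sum_lessThan_even_factor\<close>). In each VOP pair exactly one letter has an even number of gaps, and
  normalization demands that its \<open>l\<close> be even (\<open>even_gap_count_special_letters\<close>,
  \<open>normalized_iff\<close>). As there are \<open>2 * k\<close> VOP pairs (\<open>card_special_letters\<close>), extracting \<open>p + q\<close> from
  each of them leaves the sum over the normalized permutations (\<open>sum_fixed_shape\<close>).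
\<close>

section \<open>Letters in words with gaps\<close>

fun falls :: "bool list \<Rightarrow> nat" where
  "falls (x # y # zs) = (if x \<and> \<not> y then 1 else 0) + falls (y # zs)"
| "falls _ = 0"

lemma falls_append: "falls (xs @ y # ys) = falls (xs @ [y]) + falls (y # ys)"
proof (induction xs)
  case (Cons x xs)
  then show ?case by (cases xs) auto
qed auto

lemma falls_repeat: "falls (xs @ y # y # ys) = falls (xs @ y # ys)"
  using falls_append[of xs y "y # ys"] falls_append[of xs y ys] by simp

text \<open>
  The statistics of the letter \<open>u\<close> in a word. A gap is represented by a number that exceeds
  all letters, so that the usual order compares it correctly with them; the default \<open>0\<close> at both
  ends is the boundary convention for peaks and valleys. With \<open>u\<close> as threshold, descents and ascents
  across \<open>u\<close> are falls of a Boolean word, for ascents of the negated one.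
\<close>

definition shape :: "nat \<Rightarrow> nat list \<Rightarrow> bool \<times> bool" where
  "shape u w = (last (0 # takeWhile (\<lambda>x. x \<noteq> u) w) > u, hd (tl (dropWhile (\<lambda>x. x \<noteq> u) w) @ [0]) > u)"

definition falls_before :: "nat \<Rightarrow> nat list \<Rightarrow> nat" where
  "falls_before u w = falls (map (\<lambda>x. x > u) (takeWhile (\<lambda>x. x \<noteq> u) w))"

definition rises_after :: "nat \<Rightarrow> nat list \<Rightarrow> nat" where
  "rises_after u w = falls (map (\<lambda>x. \<not> x > u) (tl (dropWhile (\<lambda>x. x \<noteq> u) w)))"

lemma letter_stats_split:
  assumes "u \<notin> set A"
  shows "shape u (A @ u # B) = (last (0 # A) > u, hd (B @ [0]) > u)"
    and "falls_before u (A @ u # B) = falls (map (\<lambda>x. x > u) A)"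
    and "rises_after u (A @ u # B) = falls (map (\<lambda>x. \<not> x > u) B)"
proof -
  have "takeWhile (\<lambda>x. x \<noteq> u) (A @ u # B) = A" "dropWhile (\<lambda>x. x \<noteq> u) (A @ u # B) = u # B"
    using assms by (induction A) auto
  then show "shape u (A @ u # B) = (last (0 # A) > u, hd (B @ [0]) > u)"
    and "falls_before u (A @ u # B) = falls (map (\<lambda>x. x > u) A)"
    and "rises_after u (A @ u # B) = falls (map (\<lambda>x. \<not> x > u) B)"
    unfolding shape_def falls_before_def rises_after_def by auto
qed

text \<open>
  What replaces a gap \<open>N\<close> when the letter \<open>v\<close> is inserted into it: a gap remains on either side
  of \<open>v\<close> exactly when larger letters are still to come next to \<open>v\<close> on that side.
\<close>

definition letter_with_gaps :: "bool \<times> bool \<Rightarrow> nat \<Rightarrow> nat \<Rightarrow> nat list" where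
  "letter_with_gaps b N v = (if fst b then [N] else []) @ v # (if snd b then [N] else [])"

text \<open>
  Seen from a smaller letter \<open>u\<close>, the insertion only replaces one entry above \<open>u\<close> by several
  consecutive ones: larger neighbours of \<open>u\<close> stay larger, and the falls persist. The statistics of a
  letter are therefore final as soon as it is inserted.
\<close>

lemma letter_stats_refill:
  assumes "u \<in> set (X @ N # Y)" "u < v" "v < N"
  shows "shape u (X @ letter_with_gaps b N v @ Y) = shape u (X @ N # Y)"
    and "falls_before u (X @ letter_with_gaps b N v @ Y) = falls_before u (X @ N # Y)"
    and "rises_after u (X @ letter_with_gaps b N v @ Y) = rises_after u (X @ N # Y)"
proof -
  have "u \<in> set X \<or> u \<notin> set X \<and> u \<in> set Y"
    using assms by auto
  then have "shape u (X @ letter_with_gaps b N v @ Y) = shape u (X @ N # Y) \<and>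
    falls_before u (X @ letter_with_gaps b N v @ Y) = falls_before u (X @ N # Y) \<and> rises_after u (X @ letter_with_gaps b N v @ Y) = rises_after u (X @ N # Y)"
  proof (elim disjE conjE)
    assume "u \<in> set X"
    then obtain A B where X: "X = A @ u # B" "u \<notin> set A"
      by (meson split_list_first)
    show ?thesis
      using assms(2,3) falls_repeat[of "map (\<lambda>x. \<not> x > u) B" False "map (\<lambda>x. \<not> x > u) Y"]
        falls_repeat[of "map (\<lambda>x. \<not> x > u) B" False "False # map (\<lambda>x. \<not> x > u) Y"]
      by (cases B; cases b) (auto simp: X letter_stats_split letter_with_gaps_def)
  next
    assume u: "u \<notin> set X" "u \<in> set Y"
    then obtain A B where Y: "Y = A @ u # B" "u \<notin> set A"
      by (meson split_list_first)
    have s: "X @ letter_with_gaps b N v @ Y = (X @ letter_with_gaps b N v @ A) @ u # B" "X @ N # Y = (X @ N # A) @ u # B"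
      by (simp_all add: Y)
    have nu: "u \<notin> set (X @ letter_with_gaps b N v @ A)" "u \<notin> set (X @ N # A)"
      using u Y assms(2,3) by (auto simp: letter_with_gaps_def)
    show ?thesis
      unfolding s letter_stats_split[OF nu(1)] letter_stats_split[OF nu(2)]
      using assms(2,3) falls_repeat[of "map (\<lambda>x. x > u) X" True "map (\<lambda>x. x > u) A"]
        falls_repeat[of "map (\<lambda>x. x > u) X" True "True # map (\<lambda>x. x > u) A"]
      by (cases b) (auto simp: letter_with_gaps_def)
  qed
  then show "shape u (X @ letter_with_gaps b N v @ Y) = shape u (X @ N # Y)"
    and "falls_before u (X @ letter_with_gaps b N v @ Y) = falls_before u (X @ N # Y)"
    and "rises_after u (X @ letter_with_gaps b N v @ Y) = rises_after u (X @ N # Y)" by auto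
qed

text \<open>
  Above the threshold \<open>v\<close> there are only gaps, no two of them adjacent, so each gap is one maximal
  run of large entries and ends in a fall, unless nothing follows it.
\<close>

lemma falls_gaps:
  fixes A :: "nat list"
  assumes "set A \<subseteq> {..<v} \<union> {N}" "v < N" "distinct_adj A"
  shows "falls (map (\<lambda>x. x > v) A) + (if A \<noteq> [] \<and> last A = N then 1 else 0) = count_list A N"
  using assms
proof (induction A)
  case (Cons x A)
  then show ?case by (cases A) (auto split: if_splits)
qed auto

lemma rises_gaps:
  fixes B :: "nat list"
  assumes "set B \<subseteq> {..<v} \<union> {N}" "v < N" "distinct_adj B"
  shows "falls (map (\<lambda>x. \<not> x > v) B) + (if B \<noteq> [] \<and> hd B = N then 1 else 0) = count_list B N"
  using assms
proof (induction B)
  case (Cons x B)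
  then show ?case by (cases B) (auto split: if_splits)
qed auto

text \<open>
  The intermediate stages of a permutation, after the insertion of the letters below \<open>v\<close>, whose
  shapes are prescribed by \<open>s\<close>. Two adjacent gaps would be one gap, hence \<open>distinct_adj\<close>. The
  empty word is excluded since it arises from no permutation, yet it would satisfy all other
  conditions when \<open>v = 1\<close>.
\<close>

definition gap_words :: "(nat \<Rightarrow> bool \<times> bool) \<Rightarrow> nat \<Rightarrow> nat \<Rightarrow> nat list set" where
  "gap_words s N v = {w. w \<noteq> [] \<and> distinct_adj w \<and> distinct (removeAll N w) \<and>
     set (removeAll N w) = {1..<v} \<and> (\<forall>u \<in> {1..<v}. shape u w = s u)}"

lemma mem_gap_words:
  assumes "w \<in> gap_words s N v" "u \<in> {1..<v}"
  shows "u \<in> set w"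
proof -
  have "u \<in> set (removeAll N w)" using assms unfolding gap_words_def by blast
  then show ?thesis by simp
qed

lemma gap_words_split:
  assumes "X @ N # Y \<in> gap_words s N v" "v < N"
  shows "set X \<subseteq> {1..<v} \<union> {N}" "set Y \<subseteq> {1..<v} \<union> {N}" "distinct_adj X" "distinct_adj Y"
    "X \<noteq> [] \<Longrightarrow> last X \<noteq> N" "Y \<noteq> [] \<Longrightarrow> hd Y \<noteq> N"
  using assms by (auto simp: gap_words_def distinct_adj_append_iff distinct_adj_Cons)

text \<open>
  The gaps to the left (right) of the place of insertion become the descents to the left (ascents
  to the right) of \<open>v\<close> that pass over \<open>v\<close>.
\<close>

lemma insert_letter:
  assumes w: "X @ N # Y \<in> gap_words s N v" and v: "1 \<le> v" "v < N"
  shows "X @ letter_with_gaps (s v) N v @ Y \<in> gap_words s N (Suc v)"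
    and "falls_before v (X @ letter_with_gaps (s v) N v @ Y) = count_list X N"
    and "rises_after v (X @ letter_with_gaps (s v) N v @ Y) = count_list Y N"
proof -
  note sp = gap_words_split[OF w v(2)]
  obtain b c where s: "s v = (b, c)" by fastforce
  define A where "A = X @ (if b then [N] else [])"
  define B where "B = (if c then [N] else []) @ Y"
  have eq: "X @ letter_with_gaps (s v) N v @ Y = A @ v # B"
    by (auto simp: A_def B_def letter_with_gaps_def s)
  have vA: "v \<notin> set A" and vB: "v \<notin> set B" using sp v by (auto simp: A_def B_def)
  have lX: "last (0 # X) < v" 
    using sp(1,5) v(1) last_in_set[of X] by (cases "X = []") force+
  have hY: "hd (Y @ [0]) < v" 
    using sp(2,6) v(1) hd_in_set[of Y] by (cases "Y = []") force+
  have sA: "set A \<subseteq> {..<v} \<union> {N}" "distinct_adj A" "set B \<subseteq> {..<v} \<union> {N}" "distinct_adj B"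
    using sp by (auto simp: A_def B_def distinct_adj_append_iff distinct_adj_Cons)
  have shv: "shape v (A @ v # B) = s v"
    unfolding letter_stats_split[OF vA] using lX hY v
    by (auto simp: A_def B_def s hd_append split: if_splits)
  have dA: "distinct_adj (A @ v # B)"
    using sA v vA vB last_in_set[of A] hd_in_set[of B]
    by (auto simp: distinct_adj_append_iff distinct_adj_Cons)
  have dist: "distinct (removeAll N (A @ v # B))" "set (removeAll N (A @ v # B)) = {1..<Suc v}"
    using w v sp by (auto simp: gap_words_def A_def B_def) 
  have "shape u (A @ v # B) = s u" if u: "u \<in> {1..<v}" for u
  proof -
    have "u \<in> set (X @ N # Y)" "shape u (X @ N # Y) = s u"
      using mem_gap_words[OF w u] w u unfolding gap_words_def by blast+
    then show ?thesis
      using letter_stats_refill(1)[of u X N Y v "s v"] u v eq by auto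
  qed
  then show "X @ letter_with_gaps (s v) N v @ Y \<in> gap_words s N (Suc v)"
    unfolding eq gap_words_def using dA dist shv
    by (auto simp: less_Suc_eq simp del: removeAll_append)
  show "falls_before v (X @ letter_with_gaps (s v) N v @ Y) = count_list X N"
    unfolding eq letter_stats_split[OF vA] 
    using falls_gaps[OF sA(1) v(2) sA(2)] sp(5) by (auto simp: A_def split: if_splits)
  show "rises_after v (X @ letter_with_gaps (s v) N v @ Y) = count_list Y N"
    unfolding eq letter_stats_split[OF vA] 
    using rises_gaps[OF sA(3) v(2) sA(4)] sp(6) by (auto simp: B_def hd_append split: if_splits)
qed

text \<open>
  The inverse step: \<open>v\<close> merges with the gaps adjacent to it into a single gap. Since \<open>v\<close> is the
  largest letter, its shape says on which sides there is such a gap, so nothing is lost.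
\<close>

lemma remove_letter:
  assumes w: "w \<in> gap_words s N (Suc v)" and v: "1 \<le> v" "v < N"
  obtains X Y where "X @ N # Y \<in> gap_words s N v" "w = X @ letter_with_gaps (s v) N v @ Y"
proof -
  have "v \<in> set w" using w v unfolding gap_words_def by (auto simp: set_eq_iff)
  then obtain A B where AB: "w = A @ v # B" "v \<notin> set A"
    by (meson split_list_first)
  obtain b c where s: "s v = (b, c)" by fastforce
  have dw: "distinct_adj (A @ v # B)" "distinct (removeAll N (A @ v # B))"
    "set (removeAll N (A @ v # B)) = {1..<Suc v}" "shape v (A @ v # B) = s v"
    using w v by (auto simp: gap_words_def AB)
  have sA: "set A \<subseteq> {1..<v} \<union> {N}" "set B \<subseteq> {1..<v} \<union> {N}"
    using dw(2,3) v AB(2) by (auto simp: set_eq_iff less_Suc_eq)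
  define X where "X = (if b then butlast A else A)"
  define Y where "Y = (if c then tl B else B)"
  have b: "b \<longleftrightarrow> last (0 # A) = N" "c \<longleftrightarrow> hd (B @ [0]) = N"
    using dw(4) sA last_in_set[of A] hd_in_set[of B] v unfolding letter_stats_split[OF AB(2)] s
    by (cases "A = []"; cases "B = []"; force)+
  have A: "A = X @ (if b then [N] else [])" 
    using b(1) v append_butlast_last_id[of A] by (auto simp: X_def split: if_splits)
  have B: "B = (if c then [N] else []) @ Y"
    using b(2) v by (cases B) (auto simp: Y_def)
  have eq: "w = X @ letter_with_gaps (s v) N v @ Y"
    unfolding AB by (subst A, subst B) (simp add: letter_with_gaps_def s)
  have X: "X \<noteq> [] \<Longrightarrow> last X \<noteq> N" 
    using b(1) dw(1) A by (cases b) (auto simp: distinct_adj_append_iff)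
  have Y: "Y \<noteq> [] \<Longrightarrow> hd Y \<noteq> N" 
    using b(2) dw(1) B by (cases c) (auto simp: distinct_adj_append_iff distinct_adj_Cons)
  have dXY: "distinct_adj (X @ N # Y)"
    using dw(1) X Y A B by (auto simp: distinct_adj_append_iff distinct_adj_Cons split: if_splits)
  have rm: "distinct (removeAll N (X @ N # Y))" "set (removeAll N (X @ N # Y)) = {1..<v}"
  proof -
    have *: "removeAll N (A @ v # B) = removeAll N X @ v # removeAll N Y"
      by (subst A, subst B) (use v in auto)
    show "distinct (removeAll N (X @ N # Y))" using dw(2) unfolding * by auto
    have "set (removeAll N (X @ N # Y)) = set (removeAll N (A @ v # B)) - {v}"
      using dw(2) unfolding * by auto
    also have "\<dots> = {1..<v}" unfolding dw(3) by auto
    finally show "set (removeAll N (X @ N # Y)) = {1..<v}" .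
  qed
  have "shape u (X @ N # Y) = s u" if u: "u \<in> {1..<v}" for u
  proof -
    have "u \<in> set (removeAll N (X @ N # Y))" unfolding rm(2) by (rule u)
    then have "u \<in> set (X @ N # Y)" by (simp only: set_removeAll Diff_iff)
    then have "shape u w = shape u (X @ N # Y)"
      unfolding eq by (rule letter_stats_refill(1)) (use u v in auto)
    then show ?thesis using w u by (auto simp: gap_words_def)
  qed
  then have "X @ N # Y \<in> gap_words s N v"
    using dXY rm by (auto simp: gap_words_def)
  then show ?thesis using eq that by blast
qed

section \<open>Gaps as choices\<close>

text \<open>
  The number of gaps just before \<open>v\<close> is inserted: a valley splits a gap in two, a peak closes one,
  all other letters preserve the number. It depends on the shapes alone.
\<close>

definition gap_count :: "(nat \<Rightarrow> bool \<times> bool) \<Rightarrow> nat \<Rightarrow> int" where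
  "gap_count s v = 1 + int (card {u \<in> {1..<v}. s u = (True, True)})
     - int (card {u \<in> {1..<v}. s u = (False, False)})"

lemma gap_count_Suc:
  assumes "1 \<le> v"
  shows "gap_count s (Suc v) = gap_count s v + of_bool (fst (s v)) + of_bool (snd (s v)) - 1"
proof -
  have "{u \<in> {1..<Suc v}. s u = b} =
      (if s v = b then insert v {u \<in> {1..<v}. s u = b} else {u \<in> {1..<v}. s u = b})" for b
    using assms by (auto simp: less_Suc_eq)
  then show ?thesis
    unfolding gap_count_def by (cases "s v") auto
qed

lemma gap_words_1: "gap_words s N 1 = {[N]}"
proof -
  have "w = [N]" if "w \<noteq> []" "distinct_adj w" "set w - {N} = {}" for w
    using that by (cases w rule: remdups_adj.cases) auto
  then show ?thesis by (auto simp: gap_words_def)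
qed

lemma count_list_gap_words:
  assumes "1 \<le> v" "v \<le> N" "w \<in> gap_words s N v"
  shows "int (count_list w N) = gap_count s v"
  using assms
proof (induction v arbitrary: w rule: nat_induct_at_least)
  case base
  then show ?case using gap_words_1[of s N] by (auto simp: gap_count_def)
next
  case (Suc v)
  then obtain X Y where "X @ N # Y \<in> gap_words s N v" "w = X @ letter_with_gaps (s v) N v @ Y"
    using remove_letter[of w s N v] by auto
  with Suc show ?case
    by (force simp: gap_count_Suc letter_with_gaps_def)
qed

lemma falls_before_plus_rises_after:
  assumes "1 \<le> v" "v \<le> N" "w \<in> gap_words s N v" "u \<in> {1..<v}"
  shows "int (falls_before u w + rises_after u w) = gap_count s u - 1"
  using assms
proof (induction v arbitrary: w rule: nat_induct_at_least)
  case (Suc v)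
  then obtain X Y where XY: "X @ N # Y \<in> gap_words s N v" and w: "w = X @ letter_with_gaps (s v) N v @ Y"
    using remove_letter[of w s N v] by auto
  show ?case
  proof (cases "u = v")
    case True
    then show ?thesis
      using insert_letter(2,3)[OF XY] count_list_gap_words[OF _ _ XY] Suc.hyps Suc.prems w by simp
  next
    case False
    then have "u \<in> set (X @ N # Y)" "u < v"
      using mem_gap_words[OF XY] Suc.prems by auto
    then show ?thesis
      unfolding w using letter_stats_refill[of u X N Y v "s v"] Suc.IH[OF _ XY] Suc.prems by simp
  qed
qed auto

lemma nth_gap_split:
  assumes "l < count_list w N"
  shows "\<exists>X Y. w = X @ N # Y \<and> count_list X N = l"
  using assms
proof (induction w arbitrary: l)
  case (Cons x w)
  show ?case
  proof (cases "x = N \<and> l = 0")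
    case True
    then show ?thesis by (intro exI[of _ "[]"] exI[of _ w]) auto
  next
    case False
    with Cons.prems have "l - of_bool (x = N) < count_list w N"
      by (auto split: if_splits)
    then obtain X Y where "w = X @ N # Y" "count_list X N = l - of_bool (x = N)"
      using Cons.IH by blast
    with False show ?thesis by (intro exI[of _ "x # X"] exI[of _ Y]) auto
  qed
qed auto

lemma gap_split_unique:
  assumes "X @ N # Y = X' @ N # Y'" "count_list X N = count_list X' N"
  shows "X = X' \<and> Y = Y'"
  using assms
proof (induction X arbitrary: X')
  case Nil
  then show ?case by (cases X') auto
next
  case (Cons x X)
  then show ?case by (cases X') (auto split: if_splits)
qed

text \<open>
  A word is determined by the choice, for each letter, of the gap that received it, and every
  sequence of choices occurs. By the invariance of the statistics of smaller letters, the chosen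
  gaps can all be read off the final word.
\<close>

lemma bij_betw_gap_words:
  assumes "1 \<le> v" "v \<le> N"
  shows "bij_betw (\<lambda>w. \<lambda>u\<in>{1..<v}. falls_before u w) (gap_words s N v)
           (\<Pi>\<^sub>E u\<in>{1..<v}. {..<nat (gap_count s u)})"
proof (rule bij_betw_imageI)
  show "inj_on (\<lambda>w. \<lambda>u\<in>{1..<v}. falls_before u w) (gap_words s N v)"
    using assms
  proof (induction v rule: nat_induct_at_least)
    case base
    show ?case using gap_words_1[of s N] by (auto simp: inj_on_def)
  next
    case (Suc v)
    then have v: "1 \<le> v" "v < N" by auto
    then have inj: "inj_on (\<lambda>w. \<lambda>u\<in>{1..<v}. falls_before u w) (gap_words s N v)"
      by (intro Suc.IH) auto
    show ?case
    proof (rule inj_onI)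
      fix w w'
      assume "w \<in> gap_words s N (Suc v)" "w' \<in> gap_words s N (Suc v)"
        and "(\<lambda>u\<in>{1..<Suc v}. falls_before u w) = (\<lambda>u\<in>{1..<Suc v}. falls_before u w')"
      then have eq: "falls_before u w = falls_before u w'" if "u \<in> {1..<Suc v}" for u
        using that by (metis restrict_apply')
      obtain X Y where XY: "X @ N # Y \<in> gap_words s N v" and w: "w = X @ letter_with_gaps (s v) N v @ Y"
        using remove_letter \<open>w \<in> _\<close> v by metis
      obtain X' Y' where XY': "X' @ N # Y' \<in> gap_words s N v" and w': "w' = X' @ letter_with_gaps (s v) N v @ Y'"
        using remove_letter \<open>w' \<in> _\<close> v by metis
      have "falls_before u (X @ N # Y) = falls_before u (X' @ N # Y')" if u: "u \<in> {1..<v}" for u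
      proof -
        have "u \<in> set (X @ N # Y)" "u \<in> set (X' @ N # Y')"
          using mem_gap_words[OF XY u] mem_gap_words[OF XY' u] by simp_all
        then show ?thesis
          using letter_stats_refill(2)[of u _ N _ v "s v"] u v eq[of u] unfolding w w' by auto
      qed
      then have "(\<lambda>u\<in>{1..<v}. falls_before u (X @ N # Y)) = (\<lambda>u\<in>{1..<v}. falls_before u (X' @ N # Y'))"
        by (intro restrict_ext) auto
      then have "X @ N # Y = X' @ N # Y'"
        by (rule inj_onD[OF inj _ XY XY'])
      moreover have "count_list X N = count_list X' N"
        using eq[of v] insert_letter(2)[OF XY v] insert_letter(2)[OF XY' v] v unfolding w w' by simp
      ultimately show "w = w'"
        using gap_split_unique[of X N Y X' Y'] unfolding w w' by simp
    qed
  qed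
next
  show "(\<lambda>w. \<lambda>u\<in>{1..<v}. falls_before u w) ` gap_words s N v = (\<Pi>\<^sub>E u\<in>{1..<v}. {..<nat (gap_count s u)})"
  proof (intro equalityI subsetI)
    fix f assume "f \<in> (\<lambda>w. \<lambda>u\<in>{1..<v}. falls_before u w) ` gap_words s N v"
    then obtain w where w: "w \<in> gap_words s N v" "f = (\<lambda>u\<in>{1..<v}. falls_before u w)" by auto
    have "falls_before u w < nat (gap_count s u)" if "u \<in> {1..<v}" for u
      using falls_before_plus_rises_after[OF assms w(1) that] by simp
    then show "f \<in> (\<Pi>\<^sub>E u\<in>{1..<v}. {..<nat (gap_count s u)})"
      unfolding w(2) by auto
  next
    fix f assume "f \<in> (\<Pi>\<^sub>E u\<in>{1..<v}. {..<nat (gap_count s u)})"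
    with assms show "f \<in> (\<lambda>w. \<lambda>u\<in>{1..<v}. falls_before u w) ` gap_words s N v"
    proof (induction v arbitrary: f rule: nat_induct_at_least)
      case base
      then show ?case using gap_words_1[of s N] by auto
    next
      case (Suc v)
      then have v: "1 \<le> v" "v < N" by auto
      have "restrict f {1..<v} \<in> (\<Pi>\<^sub>E u\<in>{1..<v}. {..<nat (gap_count s u)})"
        using Suc.prems by (auto simp: PiE_iff)
      then obtain w where w: "w \<in> gap_words s N v" "restrict f {1..<v} = (\<lambda>u\<in>{1..<v}. falls_before u w)"
        using Suc.IH[of "restrict f {1..<v}"] v by (blast dest: less_imp_le)
      have "f v < nat (gap_count s v)"
        using Suc.prems v by (auto simp: PiE_iff)
      then have "f v < count_list w N"
        using count_list_gap_words[OF _ _ w(1)] v by simp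
      then obtain X Y where XY: "w = X @ N # Y" "count_list X N = f v"
        using nth_gap_split by metis
      define w' where "w' = X @ letter_with_gaps (s v) N v @ Y"
      have w': "w' \<in> gap_words s N (Suc v)" "falls_before v w' = f v"
        using insert_letter[of X N Y s v] w XY v unfolding w'_def by auto
      have "falls_before u w' = f u" if u: "u \<in> {1..<v}" for u
      proof -
        have "u \<in> set (X @ N # Y)"
          using mem_gap_words[OF w(1) u] XY by simp
        then have "falls_before u w' = falls_before u w"
          unfolding w'_def XY(1) by (rule letter_stats_refill(2)) (use u v in auto)
        also have "\<dots> = f u" using w(2) u by (metis restrict_apply')
        finally show ?thesis .
      qed
      then have "(\<lambda>u\<in>{1..<Suc v}. falls_before u w') = restrict f {1..<Suc v}"
        using w'(2) by (intro restrict_ext) (auto simp: less_Suc_eq)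
      also have "\<dots> = f" using Suc.prems(2) by (rule PiE_restrict)
      finally show ?case using w'(1) by (metis image_eqI)
    qed
  qed
qed

section \<open>Permutations with prescribed shapes\<close>

definition word_of :: "nat \<Rightarrow> (nat \<Rightarrow> nat) \<Rightarrow> nat list" where
  "word_of m \<sigma> = map \<sigma> [1..<Suc m]"

definition perm_shape :: "nat \<Rightarrow> (nat \<Rightarrow> nat) \<Rightarrow> nat \<Rightarrow> bool \<times> bool" where
  "perm_shape m \<sigma> u = (letter m \<sigma> (inv \<sigma> u - 1) > u, letter m \<sigma> (inv \<sigma> u + 1) > u)"

text \<open>
  Connects the recursive counting in words with the counting of positions in permutations.
\<close>

lemma falls_map_upt:
  "falls (map P [a..<b]) = card {i. a < i \<and> i < b \<and> P (i - 1) \<and> \<not> P i}"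
proof (induction b)
  case (Suc b)
  have "{i. a < i \<and> i < Suc b \<and> P (i - 1) \<and> \<not> P i} =
      (if a < b \<and> P (b - 1) \<and> \<not> P b then insert b else id) {i. a < i \<and> i < b \<and> P (i - 1) \<and> \<not> P i}"
    by (auto simp: less_Suc_eq)
  moreover have "falls (map P [a..<Suc b]) =
      falls (map P [a..<b]) + (if a < b \<and> P (b - 1) \<and> \<not> P b then 1 else 0)"
  proof (cases "a < b")
    case True
    then obtain c where c: "b = Suc c" "a \<le> c" by (cases b) auto
    then show ?thesis
      using falls_append[of "map P [a..<c]" "P c" "[P b]"] by simp
  qed auto
  ultimately show ?case using Suc.IH by simp
qed auto

lemma word_of_split:
  assumes \<sigma>: "\<sigma> permutes {1..m}" and u: "u \<in> {1..m}"
  defines "j \<equiv> inv \<sigma> u"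
  shows "j \<in> {1..m}" "\<sigma> j = u" "\<And>i. \<sigma> i = u \<longleftrightarrow> i = j"
    and "word_of m \<sigma> = map \<sigma> [1..<j] @ u # map \<sigma> [Suc j..<Suc m]"
    and "u \<notin> set (map \<sigma> [1..<j])"
proof -
  show j: "j \<in> {1..m}" unfolding j_def using permutes_in_image[OF permutes_inv[OF \<sigma>]] u by blast
  show sj: "\<sigma> j = u" unfolding j_def by (rule permutes_inverses[OF \<sigma>])
  show inj: "\<sigma> i = u \<longleftrightarrow> i = j" for i
    unfolding j_def using permutes_inv_eq[OF \<sigma>, of u i] by auto
  have "[1..<Suc m] = [1..<j] @ j # [Suc j..<Suc m]"
    using j upt_add_eq_append[of 1 j "Suc m - j"] upt_conv_Cons[of j "Suc m"] by auto
  then show "word_of m \<sigma> = map \<sigma> [1..<j] @ u # map \<sigma> [Suc j..<Suc m]"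
    unfolding word_of_def using sj by simp
  show "u \<notin> set (map \<sigma> [1..<j])" by (auto dest!: inj[THEN iffD1, OF sym])
qed

lemma letter_stats_word_of:
  assumes \<sigma>: "\<sigma> permutes {1..m}" and u: "u \<in> {1..m}"
  shows "shape u (word_of m \<sigma>) = perm_shape m \<sigma> u"
    and "falls_before u (word_of m \<sigma>) = embracing \<sigma> u"
    and "rises_after u (word_of m \<sigma>) = card {j. inv \<sigma> u < j \<and> j + 1 \<le> m \<and> \<sigma> (j + 1) > u \<and> u > \<sigma> j}"
proof -
  define j where "j = inv \<sigma> u"
  note sp = word_of_split[OF \<sigma> u, folded j_def]
  have ne: "\<sigma> i \<noteq> u" if "i \<noteq> j" for i using sp(3) that by blast
  have l: "last (0 # map \<sigma> [1..<j]) = letter m \<sigma> (j - 1)"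
    using sp(1) by (cases "j = 1") (auto simp: letter_def last_map)
  have r: "hd (map \<sigma> [Suc j..<Suc m] @ [0]) = letter m \<sigma> (j + 1)"
    using sp(1) by (cases "j = m") (auto simp: letter_def upt_conv_Cons simp del: upt_Suc)
  show "shape u (word_of m \<sigma>) = perm_shape m \<sigma> u"
    unfolding sp(4) letter_stats_split(1)[OF sp(5)] perm_shape_def j_def[symmetric] l r by (rule refl)
  have "\<not> u < \<sigma> i \<longleftrightarrow> \<sigma> i < u" if "i < j" for i
    using ne[of i] that by linarith
  then have "{i. 1 < i \<and> i < j \<and> u < \<sigma> (i - 1) \<and> \<not> u < \<sigma> i} = {i. 2 \<le> i \<and> i < j \<and> \<sigma> (i - 1) > u \<and> u > \<sigma> i}"
    by (intro Collect_cong) (auto simp: numeral_2_eq_2)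
  then show "falls_before u (word_of m \<sigma>) = embracing \<sigma> u"
    unfolding sp(4) letter_stats_split(2)[OF sp(5)] map_map o_def falls_map_upt embracing_def
      j_def[symmetric]
    by (rule arg_cong)
  have "{i. Suc j < i \<and> i < Suc m \<and> \<not> u < \<sigma> (i - 1) \<and> \<not> \<not> u < \<sigma> i} =
      Suc ` {i. j < i \<and> i + 1 \<le> m \<and> \<sigma> (i + 1) > u \<and> u > \<sigma> i}" (is "?L = Suc ` ?R")
  proof (intro equalityI subsetI)
    fix i assume i: "i \<in> ?L"
    then have "i - 1 \<noteq> j" "\<not> u < \<sigma> (i - 1)" by auto
    then have "\<sigma> (i - 1) < u" using ne by (meson nat_neq_iff)
    with i show "i \<in> Suc ` ?R" by (intro image_eqI[of _ _ "i - 1"]) auto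
  qed auto
  then have "card {i. Suc j < i \<and> i < Suc m \<and> \<not> u < \<sigma> (i - 1) \<and> \<not> \<not> u < \<sigma> i} = card ?R"
    by (simp add: card_image)
  then show "rises_after u (word_of m \<sigma>) = card {j. inv \<sigma> u < j \<and> j + 1 \<le> m \<and> \<sigma> (j + 1) > u \<and> u > \<sigma> j}"
    unfolding sp(4) letter_stats_split(3)[OF sp(5)] map_map o_def falls_map_upt j_def[symmetric] .
qed

lemma stat_31_2_eq_sum:
  assumes \<sigma>: "\<sigma> permutes {1..m}"
  shows "stat_31_2 m \<sigma> = (\<Sum>u\<in>{1..m}. embracing \<sigma> u)"
proof -
  let ?D = "\<lambda>j. {i. 2 \<le> i \<and> i < j \<and> \<sigma> (i - 1) > \<sigma> j \<and> \<sigma> j > \<sigma> i}"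
  have "{(i, j). 2 \<le> i \<and> i < j \<and> j \<le> m \<and> \<sigma> (i - 1) > \<sigma> j \<and> \<sigma> j > \<sigma> i} =
      prod.swap ` (SIGMA j:{1..m}. ?D j)"
    by (auto simp: image_iff)
  then have "stat_31_2 m \<sigma> = card (SIGMA j:{1..m}. ?D j)"
    unfolding stat_31_2_def by (simp add: card_image)
  also have "\<dots> = (\<Sum>j\<in>{1..m}. card (?D j))"
    by (subst card_SigmaI) auto
  also have "\<dots> = (\<Sum>j\<in>{1..m}. embracing \<sigma> (\<sigma> j))"
    by (simp add: embracing_def permutes_inverses[OF \<sigma>])
  also have "\<dots> = (\<Sum>u\<in>{1..m}. embracing \<sigma> u)"
    by (rule sum.reindex_bij_betw[OF permutes_imp_bij[OF \<sigma>]])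
  finally show ?thesis .
qed

lemma stat_2_13_eq_sum:
  assumes \<sigma>: "\<sigma> permutes {1..m}"
  shows "stat_2_13 m \<sigma> = (\<Sum>u\<in>{1..m}. rises_after u (word_of m \<sigma>))"
proof -
  let ?D = "\<lambda>i. {j. i < j \<and> j + 1 \<le> m \<and> \<sigma> (j + 1) > \<sigma> i \<and> \<sigma> i > \<sigma> j}"
  have "{(i, j). 1 \<le> i \<and> i < j \<and> j + 1 \<le> m \<and> \<sigma> (j + 1) > \<sigma> i \<and> \<sigma> i > \<sigma> j} =
      (SIGMA i:{1..m}. ?D i)"
    by auto
  then have "stat_2_13 m \<sigma> = card (SIGMA i:{1..m}. ?D i)"
    unfolding stat_2_13_def by simp
  also have "\<dots> = (\<Sum>i\<in>{1..m}. card (?D i))"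
    by (subst card_SigmaI) (auto intro: finite_subset[of _ "{..m}"])
  also have "\<dots> = (\<Sum>i\<in>{1..m}. rises_after (\<sigma> i) (word_of m \<sigma>))"
    using permutes_in_image[OF \<sigma>]
    by (intro sum.cong refl) (subst letter_stats_word_of(3)[OF \<sigma>], auto simp: permutes_inverses[OF \<sigma>])
  also have "\<dots> = (\<Sum>u\<in>{1..m}. rises_after u (word_of m \<sigma>))"
    by (rule sum.reindex_bij_betw[OF permutes_imp_bij[OF \<sigma>]])
  finally show ?thesis .
qed

definition perms_of_shape :: "(nat \<Rightarrow> bool \<times> bool) \<Rightarrow> nat \<Rightarrow> (nat \<Rightarrow> nat) set" where
  "perms_of_shape s m = {\<sigma>. \<sigma> permutes {1..m} \<and> (\<forall>u\<in>{1..m}. perm_shape m \<sigma> u = s u)}"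

lemma word_of_in_gap_words:
  assumes "\<sigma> \<in> perms_of_shape s m" "1 \<le> m"
  shows "word_of m \<sigma> \<in> gap_words s (Suc m) (Suc m)" "Suc m \<notin> set (word_of m \<sigma>)"
proof -
  have \<sigma>: "\<sigma> permutes {1..m}" using assms by (simp add: perms_of_shape_def)
  have set: "set (word_of m \<sigma>) = {1..m}"
    using permutes_image[OF \<sigma>] by (simp add: word_of_def atLeastLessThanSuc_atLeastAtMost del: upt_Suc)
  then show "Suc m \<notin> set (word_of m \<sigma>)" by simp
  then have rm: "removeAll (Suc m) (word_of m \<sigma>) = word_of m \<sigma>" by (rule removeAll_id)
  have dist: "distinct (word_of m \<sigma>)"
    using permutes_inj_on[OF \<sigma>] by (simp add: word_of_def distinct_map del: upt_Suc)
  then have "distinct_adj (word_of m \<sigma>)"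
    by (auto simp: distinct_adj_conv_nth nth_eq_iff_index_eq)
  then show "word_of m \<sigma> \<in> gap_words s (Suc m) (Suc m)"
    using assms dist set letter_stats_word_of(1)[OF \<sigma>]
    unfolding gap_words_def mem_Collect_eq rm
    by (auto simp: perms_of_shape_def)
qed

text \<open>
  When the prescribed shapes leave no gap at the end, the final stages are exactly the words of
  permutations. The number \<open>m + 1\<close> serves as the gap.
\<close>

lemma bij_betw_word_of:
  assumes m: "1 \<le> m" and s: "gap_count s (Suc m) = 0"
  shows "bij_betw (word_of m) (perms_of_shape s m) (gap_words s (Suc m) (Suc m))"
proof (rule bij_betw_imageI)
  show "inj_on (word_of m) (perms_of_shape s m)"
  proof (rule inj_onI)
    fix \<sigma> \<tau> assume *: "\<sigma> \<in> perms_of_shape s m" "\<tau> \<in> perms_of_shape s m" "word_of m \<sigma> = word_of m \<tau>"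
    then have "\<sigma> i = \<tau> i" if "i \<in> {1..m}" for i
      using that by (auto simp: word_of_def simp del: upt_Suc)
    moreover have "\<sigma> i = \<tau> i" if "i \<notin> {1..m}" for i
    proof -
      have "\<sigma> permutes {1..m}" "\<tau> permutes {1..m}"
        using * unfolding perms_of_shape_def by blast+
      then show ?thesis using permutes_not_in[OF _ that] by metis
    qed
    ultimately show "\<sigma> = \<tau>" by blast
  qed
  show "word_of m ` perms_of_shape s m = gap_words s (Suc m) (Suc m)"
  proof (intro equalityI subsetI)
    fix w assume w: "w \<in> gap_words s (Suc m) (Suc m)"
    have "count_list w (Suc m) = 0"
      using count_list_gap_words[OF _ _ w] s by simp
    then have "Suc m \<notin> set w" by (simp add: count_list_0_iff)
    then have rm: "removeAll (Suc m) w = w" by (rule removeAll_id)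
    have dist: "distinct w" and set: "set w = {1..m}"
      using w unfolding gap_words_def mem_Collect_eq rm by auto
    have len: "length w = m" using distinct_card[OF dist] set by simp
    define \<sigma> where "\<sigma> i = (if i \<in> {1..m} then w ! (i - 1) else i)" for i
    have "bij_betw (\<lambda>i. w ! i) {..<m} {1..m}"
      using bij_betw_nth[OF dist] len set by blast
    moreover have "bij_betw (\<lambda>i. i - 1) {1..m} {..<m}"
      by (rule bij_betwI[of _ _ _ Suc]) auto
    ultimately have "bij_betw ((\<lambda>i. w ! i) \<circ> (\<lambda>i. i - 1)) {1..m} {1..m}"
      by (rule bij_betw_trans[rotated])
    then have "bij_betw \<sigma> {1..m} {1..m}"
      by (rule bij_betw_cong[THEN iffD1, rotated]) (auto simp: \<sigma>_def)
    then have \<sigma>: "\<sigma> permutes {1..m}"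
      by (rule bij_imp_permutes) (auto simp: \<sigma>_def)
    have word: "word_of m \<sigma> = w"
      by (rule nth_equalityI) (auto simp: word_of_def \<sigma>_def len simp del: upt_Suc)
    have "\<sigma> \<in> perms_of_shape s m"
      using w \<sigma> letter_stats_word_of(1)[OF \<sigma>] word by (auto simp: perms_of_shape_def gap_words_def)
    with word show "w \<in> word_of m ` perms_of_shape s m" by blast
  qed (use word_of_in_gap_words m in blast)
qed

lemma gap_count_perms_of_shape:
  assumes "\<sigma> \<in> perms_of_shape s m" "1 \<le> m"
  shows "gap_count s (Suc m) = 0"
  using count_list_gap_words[OF _ _ word_of_in_gap_words(1)[OF assms]]
    word_of_in_gap_words(2)[OF assms] by simp

text \<open>
  The Laguerre histories of Francon and Viennot: permutations with given shapes correspond to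
  sequences of independent choices, one for each letter, with ranges depending on the shapes only.
\<close>

lemma bij_betw_perms_of_shape:
  assumes "1 \<le> m" "gap_count s (Suc m) = 0"
  shows "bij_betw (\<lambda>\<sigma>. \<lambda>u\<in>{1..m}. embracing \<sigma> u) (perms_of_shape s m)
           (\<Pi>\<^sub>E u\<in>{1..m}. {..<nat (gap_count s u)})"
proof -
  have "bij_betw ((\<lambda>w. \<lambda>u\<in>{1..m}. falls_before u w) \<circ> word_of m) (perms_of_shape s m)
      (\<Pi>\<^sub>E u\<in>{1..m}. {..<nat (gap_count s u)})"
    using bij_betw_trans[OF bij_betw_word_of[OF assms] bij_betw_gap_words[of "Suc m" "Suc m" s]]
    by (simp add: atLeastLessThanSuc_atLeastAtMost)
  then show ?thesis
    by (rule bij_betw_cong[THEN iffD1, rotated])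
       (auto simp: fun_eq_iff restrict_def letter_stats_word_of(2) perms_of_shape_def)
qed

lemma rises_after_word_of:
  assumes "\<sigma> \<in> perms_of_shape s m" "u \<in> {1..m}"
  shows "rises_after u (word_of m \<sigma>) = nat (gap_count s u) - 1 - embracing \<sigma> u"
    and "embracing \<sigma> u < nat (gap_count s u)"
proof -
  have \<sigma>: "\<sigma> permutes {1..m}" using assms by (simp add: perms_of_shape_def)
  have "int (falls_before u (word_of m \<sigma>) + rises_after u (word_of m \<sigma>)) = gap_count s u - 1"
    using assms by (intro falls_before_plus_rises_after[OF _ _ word_of_in_gap_words(1)]) auto
  then show "rises_after u (word_of m \<sigma>) = nat (gap_count s u) - 1 - embracing \<sigma> u"
    and "embracing \<sigma> u < nat (gap_count s u)"
    using letter_stats_word_of(2)[OF \<sigma> assms(2)] by linarith+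
qed

section \<open>Shapes of F-permutations\<close>

lemma letter_neighbours:
  assumes \<sigma>: "\<sigma> permutes {1..m}" and u: "u \<in> {1..m}"
  shows "letter m \<sigma> (inv \<sigma> u) = u" "letter m \<sigma> (inv \<sigma> u - 1) \<noteq> u" "letter m \<sigma> (inv \<sigma> u + 1) \<noteq> u"
proof -
  note sp = word_of_split(1-3)[OF \<sigma> u]
  show "letter m \<sigma> (inv \<sigma> u) = u" using sp(1,2) by (simp add: letter_def)
  have "\<sigma> (inv \<sigma> u - 1) \<noteq> u" "\<sigma> (inv \<sigma> u + 1) \<noteq> u"
    using sp(1) sp(3)[of "inv \<sigma> u - 1"] sp(3)[of "inv \<sigma> u + 1"] by auto
  then show "letter m \<sigma> (inv \<sigma> u - 1) \<noteq> u" "letter m \<sigma> (inv \<sigma> u + 1) \<noteq> u"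
    using u by (auto simp: letter_def)
qed

lemma letters_by_position:
  fixes \<sigma> :: "nat \<Rightarrow> nat"
  assumes \<sigma>: "\<sigma> permutes {1..m}"
  shows "{\<sigma> i | i. i \<in> {1..m} \<and> R i} = {u \<in> {1..m}. R (inv \<sigma> u)}"
proof (intro equalityI subsetI)
  fix u assume "u \<in> {\<sigma> i | i. i \<in> {1..m} \<and> R i}"
  then obtain i where i: "u = \<sigma> i" "i \<in> {1..m}" "R i" by blast
  moreover have "inv \<sigma> u = i" unfolding i(1) by (rule permutes_inverses(2)[OF \<sigma>])
  moreover have "u \<in> {1..m}" using i permutes_in_image[OF \<sigma>] by blast
  ultimately show "u \<in> {u \<in> {1..m}. R (inv \<sigma> u)}" by simp
next
  fix u assume "u \<in> {u \<in> {1..m}. R (inv \<sigma> u)}"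
  then have u: "u \<in> {1..m}" "R (inv \<sigma> u)" by blast+
  then show "u \<in> {\<sigma> i | i. i \<in> {1..m} \<and> R i}"
    using word_of_split(1,2)[OF \<sigma> u(1)] by (intro CollectI exI[of _ "inv \<sigma> u"]) simp
qed

lemma peaks_valleys_perm_shape:
  assumes \<sigma>: "\<sigma> permutes {1..m}"
  shows "peaks m \<sigma> = {u \<in> {1..m}. perm_shape m \<sigma> u = (False, False)}"
    and "valleys m \<sigma> = {u \<in> {1..m}. perm_shape m \<sigma> u = (True, True)}"
    and "double_descents m \<sigma> = {u \<in> {1..m}. perm_shape m \<sigma> u = (True, False)}"
proof -
  have n: "letter m \<sigma> (inv \<sigma> u - 1) < letter m \<sigma> (inv \<sigma> u) \<longleftrightarrow> \<not> fst (perm_shape m \<sigma> u)"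
    "letter m \<sigma> (inv \<sigma> u) > letter m \<sigma> (inv \<sigma> u + 1) \<longleftrightarrow> \<not> snd (perm_shape m \<sigma> u)"
    "letter m \<sigma> (inv \<sigma> u - 1) > letter m \<sigma> (inv \<sigma> u) \<longleftrightarrow> fst (perm_shape m \<sigma> u)"
    "letter m \<sigma> (inv \<sigma> u) < letter m \<sigma> (inv \<sigma> u + 1) \<longleftrightarrow> snd (perm_shape m \<sigma> u)"
    if "u \<in> {1..m}" for u
    using letter_neighbours[OF \<sigma> that] unfolding perm_shape_def fst_conv snd_conv by linarith+
  show "peaks m \<sigma> = {u \<in> {1..m}. perm_shape m \<sigma> u = (False, False)}"
    and "valleys m \<sigma> = {u \<in> {1..m}. perm_shape m \<sigma> u = (True, True)}"
    and "double_descents m \<sigma> = {u \<in> {1..m}. perm_shape m \<sigma> u = (True, False)}"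
    unfolding peaks_def valleys_def double_descents_def letters_by_position[OF \<sigma>] prod_eq_iff fst_conv snd_conv
    by (rule Collect_cong, rule conj_cong[OF refl], simp only: n simp_thms)+
qed

text \<open>
  Because of the boundary value \<open>0\<close>, the last letter looks like the top of a descent. The parity
  conditions on descents and on the last letter thus become one condition on shapes.
\<close>

lemma descents_perm_shape:
  assumes \<sigma>: "\<sigma> permutes {1..m}" and m: "1 \<le> m"
  shows "snd ` descents m \<sigma> = {u \<in> {1..m}. fst (perm_shape m \<sigma> u)}"
    and "insert (\<sigma> m) (fst ` descents m \<sigma>) = {u \<in> {1..m}. \<not> snd (perm_shape m \<sigma> u)}"
    and "inj_on snd (descents m \<sigma>)"
proof -
  have "snd ` descents m \<sigma> = {\<sigma> i | i. i \<in> {1..m} \<and> letter m \<sigma> (i - 1) > \<sigma> i}"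
  proof (intro equalityI subsetI)
    fix u assume "u \<in> {\<sigma> i | i. i \<in> {1..m} \<and> letter m \<sigma> (i - 1) > \<sigma> i}"
    then obtain i where i: "u = \<sigma> i" "i \<in> {1..m}" "letter m \<sigma> (i - 1) > \<sigma> i" by blast
    then have "2 \<le> i" "\<sigma> (i - 1) > \<sigma> i" by (auto simp: letter_def split: if_splits)
    then have "(\<sigma> (i - 1), \<sigma> i) \<in> descents m \<sigma>"
      using i by (auto simp: descents_def intro!: exI[of _ "i - 1"])
    then show "u \<in> snd ` descents m \<sigma>" using i(1) by (metis image_eqI snd_conv)
  next
    fix u assume "u \<in> snd ` descents m \<sigma>"
    then obtain i where "u = \<sigma> (i + 1)" "1 \<le> i" "i + 1 \<le> m" "\<sigma> i > \<sigma> (i + 1)"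
      by (auto simp: descents_def)
    then show "u \<in> {\<sigma> i | i. i \<in> {1..m} \<and> letter m \<sigma> (i - 1) > \<sigma> i}"
      by (intro CollectI exI[of _ "i + 1"]) (auto simp: letter_def)
  qed
  also have "\<dots> = {u \<in> {1..m}. fst (perm_shape m \<sigma> u)}"
    unfolding letters_by_position[OF \<sigma>] perm_shape_def fst_conv
    by (simp only: permutes_inverses(1)[OF \<sigma>])
  finally show "snd ` descents m \<sigma> = {u \<in> {1..m}. fst (perm_shape m \<sigma> u)}" .
  have "insert (\<sigma> m) (fst ` descents m \<sigma>) = {\<sigma> i | i. i \<in> {1..m} \<and> \<not> letter m \<sigma> (i + 1) > \<sigma> i}"
  proof (intro equalityI subsetI)
    fix u assume "u \<in> {\<sigma> i | i. i \<in> {1..m} \<and> \<not> letter m \<sigma> (i + 1) > \<sigma> i}"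
    then obtain i where i: "u = \<sigma> i" "i \<in> {1..m}" "\<not> letter m \<sigma> (i + 1) > \<sigma> i" by blast
    show "u \<in> insert (\<sigma> m) (fst ` descents m \<sigma>)"
    proof (cases "i = m")
      case False
      then have "\<not> \<sigma> (i + 1) > \<sigma> i" using i by (auto simp: letter_def)
      moreover have "\<sigma> (i + 1) \<noteq> \<sigma> i" using permutes_inj[OF \<sigma>] by (simp add: inj_eq)
      ultimately have "(\<sigma> i, \<sigma> (i + 1)) \<in> descents m \<sigma>"
        using i False by (auto simp: descents_def intro!: exI[of _ i])
      then show ?thesis using i(1) by (metis image_eqI fst_conv insertI2)
    qed (use i in simp)
  next
    fix u assume "u \<in> insert (\<sigma> m) (fst ` descents m \<sigma>)"
    then consider "u = \<sigma> m" | i where "u = \<sigma> i" "1 \<le> i" "i + 1 \<le> m" "\<sigma> i > \<sigma> (i + 1)"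
      by (auto simp: descents_def)
    then show "u \<in> {\<sigma> i | i. i \<in> {1..m} \<and> \<not> letter m \<sigma> (i + 1) > \<sigma> i}"
    proof cases
      case 1
      with m show ?thesis by (intro CollectI exI[of _ m]) (auto simp: letter_def)
    next
      case (2 i)
      then show ?thesis by (intro CollectI exI[of _ i]) (auto simp: letter_def)
    qed
  qed
  also have "\<dots> = {u \<in> {1..m}. \<not> snd (perm_shape m \<sigma> u)}"
    unfolding letters_by_position[OF \<sigma>] perm_shape_def snd_conv
    by (simp only: permutes_inverses(1)[OF \<sigma>])
  finally show "insert (\<sigma> m) (fst ` descents m \<sigma>) = {u \<in> {1..m}. \<not> snd (perm_shape m \<sigma> u)}" .
  show "inj_on snd (descents m \<sigma>)"
  proof (rule inj_onI)
    fix d e assume de: "d \<in> descents m \<sigma>" "e \<in> descents m \<sigma>" "snd d = snd e"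
    then obtain i j where "d = (\<sigma> i, \<sigma> (i + 1))" "e = (\<sigma> j, \<sigma> (j + 1))"
      unfolding descents_def by blast
    moreover from this have "i + 1 = j + 1"
      using de(3) injD[OF permutes_inj[OF \<sigma>], of "i + 1" "j + 1"] by simp
    ultimately show "d = e" by simp
  qed
qed

text \<open>
  Being an \<open>\<F>\<close>-permutation with \<open>k\<close> descents, in terms of shapes: without double
  descents, only valleys are bottoms of descents, so valleys count descents.
\<close>

definition F_shape :: "nat \<Rightarrow> nat \<Rightarrow> (nat \<Rightarrow> bool \<times> bool) \<Rightarrow> bool" where
  "F_shape n k s \<longleftrightarrow>
     (\<forall>u \<in> {1..2 * n + 1}. s u \<noteq> (True, False) \<and> (even u \<longrightarrow> s u = (False, True))) \<and>
     card {u \<in> {1..2 * n + 1}. s u = (True, True)} = k"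

lemma F_perms_des_iff:
  "\<sigma> \<in> F_perms_des n k \<longleftrightarrow>
     \<sigma> permutes {1..2 * n + 1} \<and> F_shape n k (perm_shape (2 * n + 1) \<sigma>)"
proof (cases "\<sigma> permutes {1..2 * n + 1}")
  case \<sigma>: True
  define m where "m = 2 * n + 1"
  define s where "s = perm_shape m \<sigma>"
  have m: "1 \<le> m" by (simp add: m_def)
  note \<sigma> = \<sigma>[folded m_def]
  note d = descents_perm_shape[OF \<sigma> m, folded s_def]
  note pv = peaks_valleys_perm_shape[OF \<sigma>, folded s_def]
  have "(\<forall>(a, b) \<in> descents m \<sigma>. odd a \<and> odd b) \<and> odd (\<sigma> m) \<longleftrightarrow>
      (\<forall>u \<in> insert (\<sigma> m) (fst ` descents m \<sigma>). odd u) \<and> (\<forall>u \<in> snd ` descents m \<sigma>. odd u)"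
    by (simp add: case_prod_beta ball_conj_distrib conj_ac)
  also have "\<dots> \<longleftrightarrow> (\<forall>u \<in> {1..m}. even u \<longrightarrow> s u = (False, True))"
    unfolding d prod_eq_iff fst_conv snd_conv by blast
  finally have Y: "\<sigma> \<in> Ystar n \<longleftrightarrow> (\<forall>u \<in> {1..m}. even u \<longrightarrow> s u = (False, True))"
    using \<sigma> by (simp add: Ystar_def m_def)
  have "\<sigma> m \<in> {u \<in> {1..m}. \<not> snd (s u)}" using d(2) by blast
  then have last: "\<sigma> m \<in> peaks m \<sigma>" if "double_descents m \<sigma> = {}"
    using that unfolding pv by (cases "s (\<sigma> m)") auto
  have dd: "double_descents m \<sigma> = {} \<longleftrightarrow> (\<forall>u \<in> {1..m}. s u \<noteq> (True, False))"
    unfolding pv by blast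
  define R where "R \<longleftrightarrow> (\<forall>u \<in> {1..m}. s u \<noteq> (True, False) \<and> (even u \<longrightarrow> s u = (False, True)))"
  have F: "\<sigma> \<in> F_perms n \<longleftrightarrow> R"
    unfolding R_def F_perms_def mem_Collect_eq m_def[symmetric] using Y dd last by blast
  have "card (descents m \<sigma>) = card {u \<in> {1..m}. s u = (True, True)}" if R
  proof -
    have "card (descents m \<sigma>) = card {u \<in> {1..m}. fst (s u)}"
      using card_image[OF d(3)] d(1) by simp
    also have "{u \<in> {1..m}. fst (s u)} = {u \<in> {1..m}. s u = (True, True)}"
      using that unfolding R_def prod_eq_iff fst_conv snd_conv by blast
    finally show ?thesis .
  qed
  then show ?thesis
    using \<sigma> F
    unfolding F_perms_des_def F_shape_def mem_Collect_eq m_def[symmetric] s_def[symmetric] R_def[symmetric]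
    by auto
qed (auto simp: F_perms_des_def F_perms_def Ystar_def)

lemma a_stat_perm_shape:
  assumes \<sigma>: "\<sigma> \<in> perms_of_shape s (2 * n + 1)" and j: "j \<le> 2 * n + 2"
  shows "a_stat n \<sigma> j = gap_count s j"
proof -
  have "\<sigma> permutes {1..2 * n + 1}" using \<sigma> by (simp add: perms_of_shape_def)
  note pv = peaks_valleys_perm_shape[OF this]
  have "{v \<in> {u \<in> {1..2 * n + 1}. perm_shape (2 * n + 1) \<sigma> u = b}. v < j} = {u \<in> {1..<j}. s u = b}" for b
    using \<sigma> j by (auto simp: perms_of_shape_def)
  then show ?thesis unfolding a_stat_def gap_count_def pv by simp
qed

text \<open>
  From each VOP pair the letter whose embracing number decides on normalization.
\<close>

definition special_letters :: "nat \<Rightarrow> (nat \<Rightarrow> bool \<times> bool) \<Rightarrow> nat set" where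
  "special_letters n s = (\<lambda>i. if even (gap_count s (2 * i - 1)) then 2 * i - 1 else 2 * i) `
     {i \<in> {1..n}. s (2 * i - 1) \<in> {(True, True), (False, False)}}"

lemma special_letters_subset: "special_letters n s \<subseteq> {1..2 * n + 1}"
  by (auto simp: special_letters_def)

text \<open>
  Inserting the odd letter of a VOP pair, a peak or a valley, changes the number of gaps by one,
  so exactly one letter of the pair has an even number of gaps to choose from; the
  special letter is that one.
\<close>

lemma even_gap_count_special_letters:
  assumes "u \<in> special_letters n s"
  shows "even (gap_count s u)"
proof -
  obtain i where i: "i \<in> {1..n}" "s (2 * i - 1) \<in> {(True, True), (False, False)}"
    and u: "u = (if even (gap_count s (2 * i - 1)) then 2 * i - 1 else 2 * i)"
    using assms by (auto simp: special_letters_def)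
  have "1 \<le> 2 * i - 1" "Suc (2 * i - 1) = 2 * i" using i(1) by auto
  from gap_count_Suc[OF this(1), of s, unfolded this(2)]
  have "gap_count s (2 * i) = gap_count s (2 * i - 1) + of_bool (fst (s (2 * i - 1))) + of_bool (snd (s (2 * i - 1))) - 1" .
  then show ?thesis using i(2) u by auto
qed

lemma normalized_iff:
  assumes \<sigma>: "\<sigma> \<in> perms_of_shape s (2 * n + 1)"
  shows "normalized n \<sigma> \<longleftrightarrow> (\<forall>u \<in> special_letters n s. even (embracing \<sigma> u))"
proof -
  have "\<sigma> permutes {1..2 * n + 1}" using \<sigma> by (simp add: perms_of_shape_def)
  note pv = peaks_valleys_perm_shape[OF this]
  have "2 * i - 1 \<in> {1..2 * n + 1} \<and> perm_shape (2 * n + 1) \<sigma> (2 * i - 1) = s (2 * i - 1)"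
    if "i \<in> {1..n}" for i
  proof -
    have "2 * i - 1 \<in> {1..2 * n + 1}" using that by auto
    then show ?thesis using \<sigma> unfolding perms_of_shape_def by blast
  qed
  then have "VOP_pairs n \<sigma> = {i \<in> {1..n}. s (2 * i - 1) \<in> {(True, True), (False, False)}}"
    unfolding VOP_pairs_def pv by auto
  moreover have "pair_embracing n \<sigma> i =
      embracing \<sigma> (if even (gap_count s (2 * i - 1)) then 2 * i - 1 else 2 * i)" if "i \<in> {1..n}" for i
  proof -
    have "2 * i - 1 \<le> 2 * n + 2" using that by auto
    from a_stat_perm_shape[OF \<sigma> this] show ?thesis by (simp add: pair_embracing_def)
  qed
  ultimately show ?thesis
    unfolding normalized_def special_letters_def by auto
qed

text \<open>
  There are \<open>k\<close> valleys, and since the gaps are used up at the end, one more peak than valleys.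
  All these \<open>2 * k + 1\<close> letters are odd, and all but the greatest letter \<open>2 * n + 1\<close>,
  always a peak, belong to a VOP pair.
\<close>

lemma card_special_letters:
  assumes s: "F_shape n k s" and \<sigma>: "\<sigma> \<in> perms_of_shape s (2 * n + 1)"
  shows "card (special_letters n s) = 2 * k"
proof -
  define m where "m = 2 * n + 1"
  define V where "V = {i \<in> {1..n}. s (2 * i - 1) \<in> {(True, True), (False, False)}}"
  let ?L = "\<lambda>b. {u \<in> {1..m}. s u = b}"
  have "inj_on (\<lambda>i. if even (gap_count s (2 * i - 1)) then 2 * i - 1 else 2 * i) V"
    by (auto simp: inj_on_def V_def split: if_splits; presburger)
  then have "card (special_letters n s) = card V"
    unfolding special_letters_def V_def[symmetric] by (rule card_image)
  also have "\<dots> = card ((\<lambda>i. 2 * i - 1) ` V)"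
    by (rule card_image[symmetric]) (auto simp: inj_on_def V_def)
  finally have 1: "card (special_letters n s) = card ((\<lambda>i. 2 * i - 1) ` V)" .
  have "letter m \<sigma> i \<le> m" for i
    using \<sigma> permutes_in_image[of \<sigma> "{1..m}" i]
    by (auto simp: letter_def perms_of_shape_def m_def)
  then have "perm_shape m \<sigma> m = (False, False)"
    unfolding perm_shape_def prod_eq_iff by (simp add: not_less)
  moreover have "perm_shape m \<sigma> m = s m"
  proof -
    have "m \<in> {1..m}" by (simp add: m_def)
    then show ?thesis using \<sigma> unfolding perms_of_shape_def m_def[symmetric] by blast
  qed
  ultimately have "s m = (False, False)" by simp
  have "?L (True, True) \<union> ?L (False, False) = insert m ((\<lambda>i. 2 * i - 1) ` V)"
  proof (intro equalityI subsetI)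
    fix u assume u: "u \<in> ?L (True, True) \<union> ?L (False, False)"
    then have um: "u \<in> {1..m}" and su: "s u = (True, True) \<or> s u = (False, False)" by blast+
    have "even u \<longrightarrow> s u = (False, True)"
      using s um unfolding F_shape_def m_def[symmetric] by blast
    then have "odd u" using su by auto
    then obtain i where i: "u = 2 * i + 1" by (rule oddE)
    show "u \<in> insert m ((\<lambda>i. 2 * i - 1) ` V)"
    proof (cases "i = n")
      case False
      then have "i + 1 \<in> V" using i um su unfolding V_def m_def by simp
      moreover have "u = 2 * (i + 1) - 1" using i by simp
      ultimately show ?thesis by blast
    qed (simp add: i m_def)
  next
    fix u assume "u \<in> insert m ((\<lambda>i. 2 * i - 1) ` V)"
    then consider "u = m" | i where "u = 2 * i - 1" "i \<in> V" by blast
    then show "u \<in> ?L (True, True) \<union> ?L (False, False)"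
    proof cases
      case 1
      then show ?thesis using \<open>s m = _\<close> by (simp add: m_def)
    next
      case (2 i)
      then have "u \<in> {1..m}" "s u = (True, True) \<or> s u = (False, False)"
        unfolding V_def m_def by auto
      then show ?thesis by blast
    qed
  qed
  moreover have "card (?L (True, True) \<union> ?L (False, False)) = card (?L (True, True)) + card (?L (False, False))"
    by (rule card_Un_disjoint) auto
  moreover have "m \<notin> (\<lambda>i. 2 * i - 1) ` V" by (auto simp: V_def m_def)
  moreover have "finite ((\<lambda>i. 2 * i - 1) ` V)" by (simp add: V_def)
  ultimately have 2: "card ((\<lambda>i. 2 * i - 1) ` V) + 1 = card (?L (True, True)) + card (?L (False, False))"
    by simp
  have "gap_count s (Suc m) = 0"
    using gap_count_perms_of_shape[of \<sigma> s m] \<sigma> by (simp add: m_def)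
  then have "card (?L (False, False)) = card (?L (True, True)) + 1"
    unfolding gap_count_def atLeastLessThanSuc_atLeastAtMost by linarith
  moreover have "card (?L (True, True)) = k"
    using s by (simp add: F_shape_def m_def)
  ultimately show ?thesis using 1 2 by simp
qed

section \<open>Generating functions\<close>

text \<open>
  Since the choices are independent, weights that are products over the letters sum to a product.
\<close>

lemma sum_perms_of_shape:
  fixes \<omega> :: "nat \<Rightarrow> nat \<Rightarrow> 'a :: comm_semiring_1"
  assumes "1 \<le> m" "gap_count s (Suc m) = 0"
  shows "(\<Sum>\<sigma> \<in> perms_of_shape s m. \<Prod>u\<in>{1..m}. \<omega> u (embracing \<sigma> u)) =
    (\<Prod>u\<in>{1..m}. \<Sum>l<nat (gap_count s u). \<omega> u l)"
proof -
  have "(\<Prod>u\<in>{1..m}. \<Sum>l<nat (gap_count s u). \<omega> u l) =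
      (\<Sum>f \<in> (\<Pi>\<^sub>E u\<in>{1..m}. {..<nat (gap_count s u)}). \<Prod>u\<in>{1..m}. \<omega> u (f u))"
    by (rule prod_sum_PiE) auto
  also have "\<dots> = (\<Sum>\<sigma> \<in> perms_of_shape s m. \<Prod>u\<in>{1..m}. \<omega> u ((\<lambda>u\<in>{1..m}. embracing \<sigma> u) u))"
    by (rule sum.reindex_bij_betw[OF bij_betw_perms_of_shape[OF assms], symmetric])
  finally show ?thesis by simp
qed

text \<open>
  For even \<open>a\<close>, the \<open>(p, q)\<close>-analogue of \<open>a\<close> is divisible by \<open>p + q\<close>: the terms of index \<open>l\<close>
  and \<open>l + 1\<close> with \<open>l\<close> even add up to \<open>p + q\<close> times the former term with one \<open>p\<close> removed.
\<close>

lemma sum_lessThan_even_factor: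
  fixes p q :: "'a :: comm_semiring_1"
  assumes "even a"
  shows "(\<Sum>l<a. p ^ (a - 1 - l) * q ^ l) =
    (p + q) * (\<Sum>l<a. if odd l then 0 else p ^ (a - 1 - l - 1) * q ^ l)"
proof -
  obtain h where a: "a = 2 * h" using assms by (rule evenE)
  have pairs: "(\<Sum>l<2 * h. f l) = (\<Sum>j<h. f (2 * j) + f (2 * j + 1))" for f :: "nat \<Rightarrow> 'a"
    by (induction h) (auto simp: add_ac)
  show ?thesis
    unfolding a pairs sum_distrib_left
  proof (rule sum.cong[OF refl])
    fix j assume "j \<in> {..<h}"
    then obtain d where "h = j + d + 1" by (auto dest!: less_imp_Suc_add)
    then have "2 * h - 1 - 2 * j = Suc (2 * d)" "2 * h - 1 - (2 * j + 1) = 2 * d" 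
      "2 * h - 1 - 2 * j - 1 = 2 * d" by auto
    then show "p ^ (2 * h - 1 - 2 * j) * q ^ (2 * j) + p ^ (2 * h - 1 - (2 * j + 1)) * q ^ (2 * j + 1) =
      (p + q) * ((if odd (2 * j) then 0 else p ^ (2 * h - 1 - 2 * j - 1) * q ^ (2 * j)) +
        (if odd (2 * j + 1) then 0 else p ^ (2 * h - 1 - (2 * j + 1) - 1) * q ^ (2 * j + 1)))"
      by (simp add: algebra_simps)
  qed
qed

lemma weight_eq_prod:
  fixes p q :: "'a :: comm_semiring_1"
  assumes \<sigma>: "\<sigma> \<in> perms_of_shape s m"
  shows "p ^ stat_2_13 m \<sigma> * q ^ stat_31_2 m \<sigma> =
    (\<Prod>u\<in>{1..m}. p ^ (nat (gap_count s u) - 1 - embracing \<sigma> u) * q ^ embracing \<sigma> u)"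
proof -
  have "\<sigma> permutes {1..m}" using \<sigma> by (simp add: perms_of_shape_def)
  then show ?thesis
    using rises_after_word_of(1)[OF \<sigma>]
    by (simp add: stat_2_13_eq_sum stat_31_2_eq_sum prod.distrib power_sum)
qed

text \<open>
  In a normalized permutation each special letter has an even embracing number below an even
  number of gaps. Hence its complement is odd, thus positive, and one factor \<open>p\<close> can be
  removed. In particular the exponent of \<open>p\<close> is nonnegative, so the formula also holds for \<open>p = 0\<close>.
\<close>

lemma normalized_weight_eq_prod:
  fixes p q :: "'a :: field"
  assumes \<sigma>: "\<sigma> \<in> perms_of_shape s (2 * n + 1)" and "normalized n \<sigma>" and "F_shape n k s"
  shows "p powi (int (stat_2_13 (2 * n + 1) \<sigma>) - 2 * int k) * q ^ stat_31_2 (2 * n + 1) \<sigma> =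
    (\<Prod>u\<in>{1..2 * n + 1}.
      p ^ (nat (gap_count s u) - 1 - embracing \<sigma> u - of_bool (u \<in> special_letters n s)) * q ^ embracing \<sigma> u)"
proof -
  define m where "m = 2 * n + 1"
  define C where "C = special_letters n s"
  define r where "r u = nat (gap_count s u) - 1 - embracing \<sigma> u" for u
  have perm: "\<sigma> permutes {1..m}" using \<sigma> by (simp add: perms_of_shape_def m_def)
  have C: "C \<subseteq> {1..m}" unfolding C_def m_def by (rule special_letters_subset)
  have pos: "of_bool (u \<in> C) \<le> r u" if "u \<in> {1..m}" for u
  proof (cases "u \<in> C")
    case True
    then have "even (gap_count s u)" "even (embracing \<sigma> u)"
      using even_gap_count_special_letters normalized_iff[OF \<sigma>] assms(2) by (auto simp: C_def)
    then have "even (nat (gap_count s u))" "even (embracing \<sigma> u)"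
      by (cases "0 \<le> gap_count s u"; simp add: even_nat_iff)+
    moreover have "embracing \<sigma> u < nat (gap_count s u)"
      using rises_after_word_of(2)[OF \<sigma>, of u] that by (simp add: m_def)
    moreover have "1 \<le> a - 1 - e" if "even a" "even e" "e < a" for a e :: nat
      using that by presburger
    ultimately have "1 \<le> r u" unfolding r_def by blast
    then show ?thesis by simp
  qed simp
  have "stat_2_13 m \<sigma> = (\<Sum>u\<in>{1..m}. r u)"
    unfolding stat_2_13_eq_sum[OF perm] r_def
    by (rule sum.cong[OF refl rises_after_word_of(1)]) (use \<sigma> in \<open>auto simp: m_def\<close>)
  also have "\<dots> = (\<Sum>u\<in>{1..m}. (r u - of_bool (u \<in> C)) + of_bool (u \<in> C))"
    by (rule sum.cong) (use pos in auto)
  also have "\<dots> = (\<Sum>u\<in>{1..m}. r u - of_bool (u \<in> C)) + card C"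
    using C by (simp add: sum.distrib sum.If_cases of_bool_def Int_absorb1)
  also have "card C = 2 * k"
    unfolding C_def by (rule card_special_letters[OF assms(3) \<sigma>])
  finally have "int (stat_2_13 m \<sigma>) - 2 * int k = int (\<Sum>u\<in>{1..m}. r u - of_bool (u \<in> C))"
    by simp
  then have "p powi (int (stat_2_13 m \<sigma>) - 2 * int k) = p ^ (\<Sum>u\<in>{1..m}. r u - of_bool (u \<in> C))"
    by (simp only: power_int_of_nat)
  then show ?thesis
    unfolding m_def[symmetric] C_def[symmetric] r_def[symmetric] stat_31_2_eq_sum[OF perm]
    by (simp add: power_sum prod.distrib)
qed

text \<open>
  The identity for permutations of one shape. The sum over the normalized ones is
  written as a sum over all permutations of this shape, with a product weight that vanishes unless
  every special letter has an even embracing number; then both sides are products over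
  the letters, compared factor by factor.
\<close>

lemma sum_fixed_shape:
  fixes p q :: "'a :: field"
  assumes s: "F_shape n k s" and ne: "perms_of_shape s (2 * n + 1) \<noteq> {}"
  shows "(\<Sum>\<sigma> \<in> perms_of_shape s (2 * n + 1). p ^ stat_2_13 (2 * n + 1) \<sigma> * q ^ stat_31_2 (2 * n + 1) \<sigma>) =
    (p + q) ^ (2 * k) *
      (\<Sum>\<sigma> | \<sigma> \<in> perms_of_shape s (2 * n + 1) \<and> normalized n \<sigma>.
         p powi (int (stat_2_13 (2 * n + 1) \<sigma>) - 2 * int k) * q ^ stat_31_2 (2 * n + 1) \<sigma>)"
proof -
  define m where "m = 2 * n + 1"
  define C where "C = special_letters n s"
  define S where "S = perms_of_shape s m"
  define a where "a u = nat (gap_count s u)" for u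
  (* The weight of a letter in a normalized permutation: the parity condition is an indicator, and
     one factor p is removed at each special letter. *)
  define \<omega> where "\<omega> u l = (if u \<in> C \<and> odd l then 0 else
    p ^ (a u - 1 - l - of_bool (u \<in> C)) * q ^ l)" for u l
  obtain \<sigma>0 where \<sigma>0: "\<sigma>0 \<in> S" using ne by (auto simp: S_def m_def)
  have m: "1 \<le> m" by (simp add: m_def)
  have g: "gap_count s (Suc m) = 0"
    using gap_count_perms_of_shape \<sigma>0 m unfolding S_def by blast
  have C: "C \<subseteq> {1..m}" "card C = 2 * k"
    using special_letters_subset card_special_letters[OF s] \<sigma>0 by (auto simp: C_def m_def S_def)
  have S: "finite S"
    by (rule finite_subset[OF _ finite_permutations[of "{1..m}"]]) (auto simp: S_def perms_of_shape_def)
  have "(\<Sum>\<sigma> \<in> S. p ^ stat_2_13 m \<sigma> * q ^ stat_31_2 m \<sigma>) =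
      (\<Sum>\<sigma> \<in> S. \<Prod>u\<in>{1..m}. p ^ (a u - 1 - embracing \<sigma> u) * q ^ embracing \<sigma> u)"
    unfolding S_def a_def by (intro sum.cong refl weight_eq_prod)
  also have "\<dots> = (\<Prod>u\<in>{1..m}. \<Sum>l<a u. p ^ (a u - 1 - l) * q ^ l)"
    unfolding S_def a_def by (rule sum_perms_of_shape[OF m g])
  also have "\<dots> = (\<Prod>u\<in>{1..m}. (if u \<in> C then p + q else 1) * (\<Sum>l<a u. \<omega> u l))"
  proof (rule prod.cong[OF refl])
    fix u
    show "(\<Sum>l<a u. p ^ (a u - 1 - l) * q ^ l) = (if u \<in> C then p + q else 1) * (\<Sum>l<a u. \<omega> u l)"
    proof (cases "u \<in> C")
      case True
      then have "even (a u)"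
        using even_gap_count_special_letters[of u n s]
        by (cases "0 \<le> gap_count s u") (simp_all add: C_def a_def even_nat_iff)
      from sum_lessThan_even_factor[OF this, of p q] True show ?thesis
        unfolding \<omega>_def by simp
    qed (simp add: \<omega>_def)
  qed
  also have "\<dots> = (p + q) ^ (2 * k) * (\<Prod>u\<in>{1..m}. \<Sum>l<a u. \<omega> u l)"
    using C by (simp add: prod.distrib prod.If_cases Int_absorb1)
  also have "(\<Prod>u\<in>{1..m}. \<Sum>l<a u. \<omega> u l) = (\<Sum>\<sigma> \<in> S. \<Prod>u\<in>{1..m}. \<omega> u (embracing \<sigma> u))"
    unfolding S_def a_def by (rule sum_perms_of_shape[OF m g, symmetric])
  also have "\<dots> = (\<Sum>\<sigma> \<in> S. if normalized n \<sigma>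
      then p powi (int (stat_2_13 m \<sigma>) - 2 * int k) * q ^ stat_31_2 m \<sigma> else 0)"
  proof (rule sum.cong[OF refl])
    fix \<sigma> assume "\<sigma> \<in> S"
    then have \<sigma>: "\<sigma> \<in> perms_of_shape s (2 * n + 1)" by (simp add: S_def m_def)
    show "(\<Prod>u\<in>{1..m}. \<omega> u (embracing \<sigma> u)) = (if normalized n \<sigma>
      then p powi (int (stat_2_13 m \<sigma>) - 2 * int k) * q ^ stat_31_2 m \<sigma> else 0)"
    proof (cases "normalized n \<sigma>")
      case True
      then have "\<not> (u \<in> C \<and> odd (embracing \<sigma> u))" for u
        using normalized_iff[OF \<sigma>] by (auto simp: C_def)
      then have "(\<Prod>u\<in>{1..m}. \<omega> u (embracing \<sigma> u)) =
          (\<Prod>u\<in>{1..m}. p ^ (a u - 1 - embracing \<sigma> u - of_bool (u \<in> C)) * q ^ embracing \<sigma> u)"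
        by (simp only: \<omega>_def if_False)
      then show ?thesis
        using True normalized_weight_eq_prod[OF \<sigma> True s, of p q]
        by (simp only: m_def C_def a_def if_True)
    next
      case False
      then obtain u where "u \<in> C" "odd (embracing \<sigma> u)"
        using normalized_iff[OF \<sigma>] by (auto simp: C_def)
      then have "\<exists>u\<in>{1..m}. \<omega> u (embracing \<sigma> u) = 0"
        using C(1) by (intro bexI[of _ u]) (auto simp: \<omega>_def)
      then have "(\<Prod>u\<in>{1..m}. \<omega> u (embracing \<sigma> u)) = 0"
        by (intro prod_zero) auto
      with False show ?thesis by simp
    qed
  qed
  also have "\<dots> = (\<Sum>\<sigma> | \<sigma> \<in> S \<and> normalized n \<sigma>.
      p powi (int (stat_2_13 m \<sigma>) - 2 * int k) * q ^ stat_31_2 m \<sigma>)"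
    by (rule sum.inter_filter[OF S, symmetric])
  finally show ?thesis unfolding S_def m_def .
qed

theorem theorem20:
  fixes n k :: nat and p q :: "'a :: field"
  assumes "n \<ge> 1" and "k \<le> n div 2"
  shows "(\<Sum>\<sigma> \<in> F_perms_des n k. p ^ stat_2_13 (2 * n + 1) \<sigma> * q ^ stat_31_2 (2 * n + 1) \<sigma>) =
    (p + q) ^ (2 * k) *
      (\<Sum>\<sigma> \<in> normalized_F_perms_des n k.
         p powi (int (stat_2_13 (2 * n + 1) \<sigma>) - 2 * int k) * q ^ stat_31_2 (2 * n + 1) \<sigma>)"
proof -
  define m where "m = 2 * n + 1"
  define F where "F = F_perms_des n k"
  (* Restricted to the letters, so that equality of functions is equality of shapes. *)
  define S where "S \<sigma> = (\<lambda>u\<in>{1..m}. perm_shape m \<sigma> u)" for \<sigma>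
  have fin: "finite F"
    by (rule finite_subset[OF _ finite_permutations[of "{1..m}"]])
       (auto simp: F_def F_perms_des_iff m_def)
  have cls: "F_shape n k s \<and> {\<sigma> \<in> F. S \<sigma> = s} = perms_of_shape s m \<and> perms_of_shape s m \<noteq> {}"
    if "s \<in> S ` F" for s
  proof -
    have F_shape_S: "F_shape n k (S \<sigma>) = F_shape n k (perm_shape m \<sigma>)" for \<sigma>
    proof -
      have "{u \<in> {1..m}. S \<sigma> u = (True, True)} = {u \<in> {1..m}. perm_shape m \<sigma> u = (True, True)}"
        by (intro Collect_cong conj_cong refl) (simp only: S_def restrict_apply')
      moreover have "(\<forall>u \<in> {1..m}. S \<sigma> u \<noteq> (True, False) \<and> (even u \<longrightarrow> S \<sigma> u = (False, True))) \<longleftrightarrow>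
          (\<forall>u \<in> {1..m}. perm_shape m \<sigma> u \<noteq> (True, False) \<and> (even u \<longrightarrow> perm_shape m \<sigma> u = (False, True)))"
        by (rule ball_cong[OF refl]) (simp only: S_def restrict_apply')
      ultimately show ?thesis unfolding F_shape_def m_def[symmetric] by simp
    qed
    from that obtain \<tau> where \<tau>: "\<tau> \<in> F" "s = S \<tau>" by blast
    have "F_shape n k (perm_shape m \<tau>)"
      using \<tau>(1) unfolding F_def F_perms_des_iff m_def by blast
    then have s: "F_shape n k s" unfolding \<tau>(2) F_shape_S .
    have "S \<sigma> = s \<longleftrightarrow> (\<forall>u\<in>{1..m}. perm_shape m \<sigma> u = s u)" for \<sigma>
    proof
      assume "S \<sigma> = s"
      then show "\<forall>u\<in>{1..m}. perm_shape m \<sigma> u = s u" by (auto simp: S_def)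
    next
      assume "\<forall>u\<in>{1..m}. perm_shape m \<sigma> u = s u"
      then have "perm_shape m \<sigma> u = perm_shape m \<tau> u" if "u \<in> {1..m}" for u
        using that unfolding \<tau>(2) S_def by (metis restrict_apply')
      then show "S \<sigma> = s" unfolding \<tau>(2) S_def by (rule restrict_ext)
    qed
    moreover have "\<sigma> \<in> F \<longleftrightarrow> \<sigma> permutes {1..m} \<and> F_shape n k (S \<sigma>)" for \<sigma>
      unfolding F_shape_S F_def F_perms_des_iff m_def ..
    ultimately have "{\<sigma> \<in> F. S \<sigma> = s} = perms_of_shape s m"
      using s unfolding perms_of_shape_def by (intro Collect_cong) metis
    with s \<tau> show ?thesis by blast
  qed
  let ?w = "\<lambda>\<sigma>. p ^ stat_2_13 m \<sigma> * q ^ stat_31_2 m \<sigma>"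
  let ?w' = "\<lambda>\<sigma>. p powi (int (stat_2_13 m \<sigma>) - 2 * int k) * q ^ stat_31_2 m \<sigma>"
  have "(\<Sum>\<sigma> \<in> F. ?w \<sigma>) = (\<Sum>s \<in> S ` F. \<Sum>\<sigma> | \<sigma> \<in> F \<and> S \<sigma> = s. ?w \<sigma>)"
    by (rule sum.image_gen[OF fin])
  also have "\<dots> = (\<Sum>s \<in> S ` F. (p + q) ^ (2 * k) *
      (\<Sum>\<sigma> | \<sigma> \<in> {\<sigma> \<in> F. normalized n \<sigma>} \<and> S \<sigma> = s. ?w' \<sigma>))"
  proof (rule sum.cong[OF refl])
    fix s assume "s \<in> S ` F"
    from cls[OF this] have s: "F_shape n k s" "{\<sigma> \<in> F. S \<sigma> = s} = perms_of_shape s m"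
      "perms_of_shape s m \<noteq> {}" by auto
    have "{\<sigma>. \<sigma> \<in> {\<sigma> \<in> F. normalized n \<sigma>} \<and> S \<sigma> = s} = {\<sigma>. \<sigma> \<in> perms_of_shape s m \<and> normalized n \<sigma>}"
      using s(2) by blast
    then show "(\<Sum>\<sigma> | \<sigma> \<in> F \<and> S \<sigma> = s. ?w \<sigma>) =
        (p + q) ^ (2 * k) * (\<Sum>\<sigma> | \<sigma> \<in> {\<sigma> \<in> F. normalized n \<sigma>} \<and> S \<sigma> = s. ?w' \<sigma>)"
      using sum_fixed_shape[OF s(1) s(3)[unfolded m_def], of p q]
      by (simp only: s(2) m_def)
  qed
  also have "\<dots> = (p + q) ^ (2 * k) * (\<Sum>\<sigma> \<in> {\<sigma> \<in> F. normalized n \<sigma>}. ?w' \<sigma>)"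
    unfolding sum_distrib_left[symmetric] using fin
    by (intro arg_cong2[where f = "(*)"] refl sum.group) auto
  finally show ?thesis
    unfolding F_def m_def normalized_F_perms_des_def .
qed

end
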